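(* Let $(X,\mathcal{K})$ be any one of the three pairs $(\widetilde{S}^m_{nc},K_S(\mathbb{R}^m))$, $(S^m_{nc},K_S(\mathbb{R}^m))$, $(E^m_{nc},K_C(\mathbb{R}^m))$, and let $U$ be a subset of $X$. Then the following statements are equivalent. (i) $U$ is a relatively compact set in $(X,H_{\rm end})$. (ii) $U$ is a totally bounded set in $(X,H_{\rm end})$. (iii) For each $\alpha\in(0,1]$, $U_\alpha:=\{[u]_\alpha:u\in U\}$ is a bounded set in $(K(\mathbb{R}^m),H)$. (iv) For each $\alpha\in(0,1]$, $U_\alpha$ is a bounded set in $(\mathcal{K},H)$. (v) For each $\alpha\in(0,1]$, $U(\alpha):=\bigcup_{u\in U}[u]_\alpha$ is a bounded set in $\mathbb{R}^m$.
   Context: A fuzzy set on $\mathbb{R}^m$ is a function $u:\mathbb{R}^m\to[0,1]$. For $\alpha\in(0,1]$, $[u]_\alpha=\{x:u(x)\ge\alpha\}$. Each of the following consists of upper semi-continuous fuzzy sets $u$ on $\mathbb{R}^m$ that are normal ($u(x_0)=1$ for some $x_0$), have $[u]_\alpha$ bounded for each $\alpha\in(0,1]$, and in addition: - $E^m_{nc}$: $u(\lambda x+(1-\lambda)y)\ge\min\{u(x),u(y)\}$ for all $x,y\in\mathbb{R}^m$, $\lambda\in[0,1]$; - $S^m_{nc}$: there exists $x\in\mathbb{R}^m$ such that $u(\lambda y+(1-\lambda)x)\ge u(y)$ for all $y\in\mathbb{R}^m$, $\lambda\in[0,1]$; - $\widetilde{S}^m_{nc}$: for each $\lambda\in(0,1]$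 there is $x_\lambda\in[u]_\lambda$ such that the line segment $\overline{x_\lambda y}$ is contained in $[u]_\lambda$ for all $y\in[u]_\lambda$. $K(\mathbb{R}^m)$, $K_C(\mathbb{R}^m)$, $K_S(\mathbb{R}^m)$ are the sets of all nonempty compact, nonempty compact convex, and nonempty compact star-shaped subsets of $\mathbb{R}^m$ respectively ($K$ is star-shaped if there is $x\in K$ with $\overline{xy}\subset K$ for every $y\in K$). $H(A,B)=\max\{\sup_{a\in A}\inf_{b\in B}d(a,b),\ \sup_{b\in B}\inf_{a\in A}d(a,b)\}$ is the Hausdorff metric on nonempty closed sets ($d$ Euclidean). The endograph of $u$ is ${\rm end}\,u=\{(x,t)\in\mathbb{R}^m\times[0,1]:u(x)\ge t\}$ and $H_{\rm end}(u,v)=H({\rm end}\,u,{\rm end}\,v)$. A set is relatively compact in a metric space if its closure in that space is compact. *)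

theory Defs
  imports "HOL-Analysis.Analysis"
begin

subsection \<open>Hausdorff distance\<close>

text \<open>
  The suprema and infima are taken in the extended nonnegative reals, so that the formula makes
  sense for arbitrary sets. The real-valued version is the genuine Hausdorff metric wherever the
  extended one is finite, which is the case on all the spaces considered below (see the metric
  space lemmas at the end); otherwise \<^const>\<open>enn2real\<close> returns 0.
\<close>

definition hausdorff_edist :: "'a::metric_space set \<Rightarrow> 'a set \<Rightarrow> ennreal" where
  "hausdorff_edist A B =
     max (SUP a\<in>A. INF b\<in>B. ennreal (dist a b)) (SUP b\<in>B. INF a\<in>A. ennreal (dist a b))"

definition hausdorff_dist :: "'a::metric_space set \<Rightarrow> 'a set \<Rightarrow> real" where
  "hausdorff_dist A B = enn2real (hausdorff_edist A B)"

definition compact_sets :: "(real ^ 'm::finite) set set" where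
  "compact_sets = {K. K \<noteq> {} \<and> compact K}"

definition compact_convex_sets :: "(real ^ 'm::finite) set set" where
  "compact_convex_sets = {K. K \<noteq> {} \<and> compact K \<and> convex K}"

definition compact_star_sets :: "(real ^ 'm::finite) set set" where
  "compact_star_sets = {K. K \<noteq> {} \<and> compact K \<and> starlike K}"

definition relatively_compact_in :: "'a set \<Rightarrow> ('a \<Rightarrow> 'a \<Rightarrow> real) \<Rightarrow> 'a set \<Rightarrow> bool" where
  "relatively_compact_in M d S \<longleftrightarrow>
     compactin (Metric_space.mtopology M d) (Metric_space.mtopology M d closure_of S)"

subsection \<open>Fuzzy sets\<close>

definition upper_semicontinuous :: "('a::topological_space \<Rightarrow> real) \<Rightarrow> bool" where
  "upper_semicontinuous u \<longleftrightarrow> (\<forall>x a. u x < a \<longrightarrow> (\<forall>\<^sub>F y in nhds x. u y < a))"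

definition level_set :: "('a \<Rightarrow> real) \<Rightarrow> real \<Rightarrow> 'a set" where
  "level_set u \<alpha> = {x. u x \<ge> \<alpha>}"

definition endograph :: "('a \<Rightarrow> real) \<Rightarrow> ('a \<times> real) set" where
  "endograph u = {(x, t). t \<in> {0..1} \<and> u x \<ge> t}"

text \<open>The distance on the product type is Euclidean, so this is the Hausdorff distance for the
  Euclidean metric on $m+1$ coordinates.\<close>

definition H_end :: "('a::metric_space \<Rightarrow> real) \<Rightarrow> ('a \<Rightarrow> real) \<Rightarrow> real" where
  "H_end u v = hausdorff_dist (endograph u) (endograph v)"

definition fuzzy_base :: "(real ^ 'm::finite \<Rightarrow> real) set" where
  "fuzzy_base = {u. (\<forall>x. u x \<in> {0..1}) \<and> upper_semicontinuous u \<and> (\<exists>x0. u x0 = 1) \<and>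
     (\<forall>\<alpha>\<in>{0<..1}. bounded (level_set u \<alpha>))}"

definition E_nc :: "(real ^ 'm::finite \<Rightarrow> real) set" where
  "E_nc = {u \<in> fuzzy_base.
     \<forall>x y. \<forall>l\<in>{0..1}. u (l *\<^sub>R x + (1 - l) *\<^sub>R y) \<ge> min (u x) (u y)}"

definition S_nc :: "(real ^ 'm::finite \<Rightarrow> real) set" where
  "S_nc = {u \<in> fuzzy_base.
     \<exists>x. \<forall>y. \<forall>l\<in>{0..1}. u (l *\<^sub>R y + (1 - l) *\<^sub>R x) \<ge> u y}"

definition S_tilde_nc :: "(real ^ 'm::finite \<Rightarrow> real) set" where
  "S_tilde_nc = {u \<in> fuzzy_base.
     \<forall>l\<in>{0<..1}. \<exists>x\<in>level_set u l. \<forall>y\<in>level_set u l. closed_segment x y \<subseteq> level_set u l}"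

subsection \<open>The spaces in question are metric spaces\<close>

lemma hausdorff_dist_commute: "hausdorff_dist A B = hausdorff_dist B A"
  by (simp add: hausdorff_dist_def hausdorff_edist_def max.commute dist_commute)

lemma INF_add_ennreal:
  fixes f :: "'b \<Rightarrow> ennreal"
  assumes "I \<noteq> {}"
  shows "(INF i\<in>I. f i + c) = (INF i\<in>I. f i) + c"
  using continuous_at_Inf_mono[of "\<lambda>x. x + c" "f ` I"] assms
  using continuous_add[of "at_right (Inf (f ` I))", of "\<lambda>x. x" "\<lambda>x. c"]
  by (auto simp: mono_def image_comp)

lemma excess_triangle:
  fixes A B C :: "'a::metric_space set"
  assumes "B \<noteq> {}"
  shows "(SUP a\<in>A. INF c\<in>C. ennreal (dist a c)) \<le>
    (SUP a\<in>A. INF b\<in>B. ennreal (dist a b)) + (SUP b\<in>B. INF c\<in>C. ennreal (dist b c))"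
    (is "_ \<le> ?AB + ?BC")
proof (rule SUP_least)
  fix a assume a: "a \<in> A"
  have 1: "(INF c\<in>C. ennreal (dist a c)) \<le> ennreal (dist a b) + ?BC" if b: "b \<in> B" for b
  proof (cases "C = {}")
    case True
    have "top \<le> ?BC" using b True by (intro SUP_upper2[OF b]) simp
    also have "?BC \<le> ennreal (dist a b) + ?BC" by (rule add_increasing) auto
    finally show ?thesis using order_trans[OF top_greatest] by blast
  next
    case False
    have "(INF c\<in>C. ennreal (dist a c)) \<le> (INF c\<in>C. ennreal (dist a b) + ennreal (dist b c))"
      by (rule INF_mono') (simp add: dist_triangle ennreal_leI flip: ennreal_plus)
    also have "\<dots> = ennreal (dist a b) + (INF c\<in>C. ennreal (dist b c))"
      using INF_add_ennreal[OF False, of "\<lambda>c. ennreal (dist b c)" "ennreal (dist a b)"]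
      by (simp only: add.commute)
    also have "\<dots> \<le> ennreal (dist a b) + ?BC"
      by (intro add_left_mono SUP_upper b)
    finally show ?thesis .
  qed
  have "(INF c\<in>C. ennreal (dist a c)) \<le> (INF b\<in>B. ennreal (dist a b) + ?BC)"
    by (rule INF_greatest) (rule 1)
  also have "\<dots> = (INF b\<in>B. ennreal (dist a b)) + ?BC"
    using assms by (simp add: INF_add_ennreal)
  also have "\<dots> \<le> ?AB + ?BC"
    by (intro add_right_mono SUP_upper a)
  finally show "(INF c\<in>C. ennreal (dist a c)) \<le> ?AB + ?BC" .
qed

lemma hausdorff_edist_triangle:
  assumes "B \<noteq> {}"
  shows "hausdorff_edist A C \<le> hausdorff_edist A B + hausdorff_edist B C"
proof -
  have "(SUP a\<in>A. INF c\<in>C. ennreal (dist a c)) \<le> hausdorff_edist A B + hausdorff_edist B C"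
    unfolding hausdorff_edist_def
    by (rule order_trans[OF excess_triangle[OF assms]]) (intro add_mono max.cobounded1)
  moreover have "(SUP c\<in>C. INF a\<in>A. ennreal (dist a c)) \<le> hausdorff_edist A B + hausdorff_edist B C"
  proof -
    have "(SUP c\<in>C. INF a\<in>A. ennreal (dist c a)) \<le>
        hausdorff_edist B C + hausdorff_edist A B"
      unfolding hausdorff_edist_def
      by (rule order_trans[OF excess_triangle[OF assms]], rule add_mono)
        (simp_all add: dist_commute)
    then show ?thesis by (simp add: dist_commute add.commute)
  qed
  ultimately show ?thesis by (subst hausdorff_edist_def) simp
qed

lemma hausdorff_edist_zero_subset:
  assumes "hausdorff_edist A B = 0" "closed B"
  shows "A \<subseteq> B"
proof
  fix a assume a: "a \<in> A"
  have "(SUP a\<in>A. INF b\<in>B. ennreal (dist a b)) = 0"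
    using assms(1) by (simp add: hausdorff_edist_def max_def split: if_splits)
  then have 0: "(INF b\<in>B. ennreal (dist a b)) = 0"
    using a by (metis SUP_upper le_zero_eq)
  have "\<exists>b\<in>B. dist b a < e" if "e > 0" for e
  proof -
    have "(INF b\<in>B. ennreal (dist a b)) < ennreal e" using 0 that by simp
    then show ?thesis
      by (auto simp: INF_less_iff dist_commute ennreal_less_iff)
  qed
  then have "a \<in> closure B" by (simp add: closure_approachable)
  then show "a \<in> B" using assms(2) by simp
qed

lemma hausdorff_edist_self: "hausdorff_edist A A = 0"
proof -
  have "(SUP a\<in>A. INF b\<in>A. ennreal (dist a b)) \<le> 0"
    by (intro SUP_least INF_lower2) auto
  moreover have "(SUP a\<in>A. INF b\<in>A. ennreal (dist b a)) \<le> 0"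
    by (intro SUP_least INF_lower2) auto
  ultimately show ?thesis by (simp add: hausdorff_edist_def)
qed

lemma Metric_space_hausdorff:
  assumes closed: "\<And>A. A \<in> M \<Longrightarrow> closed A \<and> A \<noteq> {}"
    and finite: "\<And>A B. A \<in> M \<Longrightarrow> B \<in> M \<Longrightarrow> hausdorff_edist A B < top"
  shows "Metric_space M hausdorff_dist"
proof
  show "0 \<le> hausdorff_dist A B" for A B :: "'a set" by (simp add: hausdorff_dist_def)
  show "hausdorff_dist A B = hausdorff_dist B A" for A B :: "'a set"
    by (rule hausdorff_dist_commute)
  show "hausdorff_dist A B = 0 \<longleftrightarrow> A = B" if "A \<in> M" "B \<in> M" for A B
  proof
    assume "hausdorff_dist A B = 0"
    then have "hausdorff_edist A B = 0" "hausdorff_edist B A = 0"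
      using finite[OF that] finite[OF that(2,1)] hausdorff_dist_commute[of A B]
      by (auto simp: hausdorff_dist_def enn2real_eq_0_iff)
    then show "A = B" using hausdorff_edist_zero_subset closed that by blast
  qed (simp add: hausdorff_dist_def hausdorff_edist_self)
  show "hausdorff_dist A C \<le> hausdorff_dist A B + hausdorff_dist B C"
    if "A \<in> M" "B \<in> M" "C \<in> M" for A B C
  proof -
    have fin: "hausdorff_edist A B < top" "hausdorff_edist B C < top"
      using finite that by blast+
    have "enn2real (hausdorff_edist A C) \<le> enn2real (hausdorff_edist A B + hausdorff_edist B C)"
      by (rule enn2real_mono) (use closed that fin in \<open>auto intro: hausdorff_edist_triangle\<close>)
    then show ?thesis using fin by (simp add: hausdorff_dist_def enn2real_plus)
  qed
qed

lemma Metric_space_compact_sets: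
  "Metric_space (compact_sets :: (real ^ 'm::finite) set set) hausdorff_dist"
proof (rule Metric_space_hausdorff)
  fix A B :: "(real ^ 'm) set" assume AB: "A \<in> compact_sets" "B \<in> compact_sets"
  then obtain a b where ab: "a \<in> A" "b \<in> B" by (auto simp: compact_sets_def)
  have "bounded (A \<union> B)" using AB by (auto simp: compact_sets_def compact_imp_bounded)
  then obtain D where D: "\<And>x y. x \<in> A \<union> B \<Longrightarrow> y \<in> A \<union> B \<Longrightarrow> dist x y \<le> D"
    unfolding bounded_two_points by blast
  have "hausdorff_edist A B \<le> ennreal D"
    unfolding hausdorff_edist_def
  proof (rule max.boundedI; rule SUP_least)
    show "(INF y\<in>B. ennreal (dist x y)) \<le> ennreal D" if "x \<in> A" for x
      by (rule INF_lower2[OF ab(2)]) (use D that ab in \<open>simp add: ennreal_leI\<close>)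
    show "(INF y\<in>A. ennreal (dist y x)) \<le> ennreal D" if "x \<in> B" for x
      by (rule INF_lower2[OF ab(1)]) (use D that ab in \<open>simp add: ennreal_leI\<close>)
  qed
  then show "hausdorff_edist A B < top" by (simp add: le_less_trans)
qed (auto simp: compact_sets_def compact_imp_closed)

lemma Metric_space_compact_star_sets:
  "Metric_space (compact_star_sets :: (real ^ 'm::finite) set set) hausdorff_dist"
  by (rule Metric_space.subspace[OF Metric_space_compact_sets])
    (auto simp: compact_sets_def compact_star_sets_def)

lemma Metric_space_compact_convex_sets:
  "Metric_space (compact_convex_sets :: (real ^ 'm::finite) set set) hausdorff_dist"
  by (rule Metric_space.subspace[OF Metric_space_compact_sets])
    (auto simp: compact_sets_def compact_convex_sets_def)

lemma closed_endograph:
  fixes u :: "'a::metric_space \<Rightarrow> real"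
  assumes "upper_semicontinuous u"
  shows "closed (endograph u)"
  unfolding closed_sequential_limits
proof (intro allI impI)
  fix z p assume "(\<forall>n. z n \<in> endograph u) \<and> z \<longlonglongrightarrow> p"
  then have z: "\<And>n. snd (z n) \<in> {0..1}" "\<And>n. snd (z n) \<le> u (fst (z n))"
    and lim: "(\<lambda>n. fst (z n)) \<longlonglongrightarrow> fst p" "(\<lambda>n. snd (z n)) \<longlonglongrightarrow> snd p"
    by (auto simp: endograph_def case_prod_beta intro: tendsto_fst tendsto_snd)
  have "snd p \<in> {0..1}"
    using closed_sequentially[OF closed_atLeastAtMost z(1) lim(2)] by simp
  moreover have "snd p \<le> u (fst p)"
  proof (rule dense_ge)
    fix a assume "u (fst p) < a"
    then have "\<forall>\<^sub>F y in nhds (fst p). u y < a"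
      using assms by (simp add: upper_semicontinuous_def)
    then have "\<forall>\<^sub>F n in sequentially. u (fst (z n)) < a"
      using lim(1) unfolding filterlim_iff by blast
    then have "\<forall>\<^sub>F n in sequentially. snd (z n) \<le> a"
      by eventually_elim (meson less_imp_le order_trans z(2))
    then show "snd p \<le> a" by (rule tendsto_upperbound[OF lim(2)]) simp
  qed
  ultimately show "p \<in> endograph u" by (simp add: endograph_def case_prod_beta)
qed

lemma Metric_space_H_end:
  "Metric_space (fuzzy_base :: (real ^ 'm::finite \<Rightarrow> real) set) H_end"
proof -
  let ?F = "fuzzy_base :: (real ^ 'm \<Rightarrow> real) set"
  have base: "(x, 0) \<in> endograph u" if "u \<in> ?F" for u x
    using that by (auto simp: endograph_def fuzzy_base_def)
  have near: "(INF q\<in>endograph v. ennreal (dist p q)) \<le> 1"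
    if "p \<in> endograph u" "v \<in> ?F" for u v :: "real ^ 'm \<Rightarrow> real" and p
  proof -
    have "dist p (fst p, 0) \<le> 1"
      using that by (auto simp: endograph_def dist_prod_def)
    then have "ennreal (dist p (fst p, 0)) \<le> 1"
      by simp
    then show ?thesis by (rule INF_lower2[OF base[OF that(2)]])
  qed
  interpret G: Metric_space "endograph ` ?F" hausdorff_dist
  proof (rule Metric_space_hausdorff)
    show "closed A \<and> A \<noteq> {}" if "A \<in> endograph ` ?F" for A
    proof -
      from that obtain u where u: "u \<in> ?F" "A = endograph u" by blast
      then have "upper_semicontinuous u" by (simp add: fuzzy_base_def)
      then show ?thesis using closed_endograph base[OF u(1)] u(2) by blast
    qed
    show "hausdorff_edist A B < top" if AB: "A \<in> endograph ` ?F" "B \<in> endograph ` ?F" for A B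
    proof -
      obtain u v where uv: "u \<in> ?F" "A = endograph u" "v \<in> ?F" "B = endograph v"
        using AB by blast
      have "hausdorff_edist A B \<le> 1"
        unfolding hausdorff_edist_def uv(2,4)
      proof (rule max.boundedI; rule SUP_least)
        show "(INF q\<in>endograph v. ennreal (dist p q)) \<le> 1" if "p \<in> endograph u" for p
          using near[OF that uv(3)] .
        show "(INF q\<in>endograph u. ennreal (dist q p)) \<le> 1" if "p \<in> endograph v" for p
          using near[OF that uv(1)] by (simp only: dist_commute)
      qed
      then show ?thesis by (rule le_less_trans) (rule ennreal_one_less_top)
    qed
  qed
  have inj: "u = v" if "u \<in> ?F" "v \<in> ?F" "endograph u = endograph v" for u v
  proof (rule ext, rule antisym)
    fix x
    have "(x, u x) \<in> endograph u" "(x, v x) \<in> endograph v"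
      using that by (auto simp: endograph_def fuzzy_base_def)
    with that(3) have "(x, u x) \<in> endograph v" "(x, v x) \<in> endograph u" by auto
    then show "u x \<le> v x" "v x \<le> u x" by (auto simp: endograph_def)
  qed
  show ?thesis
  proof
    show "0 \<le> H_end u v" "H_end u v = H_end v u" for u v :: "real ^ 'm \<Rightarrow> real"
      by (simp_all add: H_end_def G.commute)
    show "H_end u v = 0 \<longleftrightarrow> u = v" if "u \<in> ?F" "v \<in> ?F" for u v
      using that inj by (auto simp: H_end_def)
    show "H_end u w \<le> H_end u v + H_end v w" if "u \<in> ?F" "v \<in> ?F" "w \<in> ?F" for u v w
      using that G.triangle by (simp add: H_end_def)
  qed
qed

lemma Metric_space_H_end_subclasses:
  "Metric_space (E_nc :: (real ^ 'm::finite \<Rightarrow> real) set) H_end"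
  "Metric_space (S_nc :: (real ^ 'm::finite \<Rightarrow> real) set) H_end"
  "Metric_space (S_tilde_nc :: (real ^ 'm::finite \<Rightarrow> real) set) H_end"
  by (rule Metric_space.subspace[OF Metric_space_H_end];
      auto simp: E_nc_def S_nc_def S_tilde_nc_def)+

end

theory Submission
  imports Defs "HOL-Library.Diagonal_Subsequence"
begin

text \<open>Each of the five conditions says that, for every level \<open>\<alpha> > 0\<close>, all the sets \<open>[u]\<^sub>\<alpha>\<close> lie in
  one bounded set; a family with this property is called levelwise bounded below.

  For the Hausdorff-metric conditions this is elementary
  (\<open>mbounded_hausdorff_iff\<close>): a Hausdorff-bounded family is a family
  inside a bounded neighbourhood of one of its members. The surrounding space of compact sets only
  has to contain the level sets, which are compact, and convex or star-shaped according to the class.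

  Total boundedness gives levelwise boundedness because a point \<open>(x, \<alpha>)\<close> of an endograph is, up to
  \<open>\<alpha> / 2\<close>, a point of the endograph of one of finitely many fuzzy sets, so that \<open>x\<close> is near one of
  finitely many bounded \<open>\<alpha> / 2\<close>-level sets. The same shift of levels shows that the closure
  of a levelwise bounded family is levelwise bounded, so for compactness it is enough to extract, from
  any sequence of a levelwise bounded family, a subsequence that converges to a member of the class.

  The extraction goes through Kuratowski convergence of endographs. In a second countable metric space
  every sequence of nonempty sets has a Kuratowski convergent subsequence
  (\<open>kuratowski_compactness\<close>). A limit of endographs is closed, contains every \<open>(x, 0)\<close> and
  is closed under lowering the second coordinate, hence is an endograph; levelwise boundedness keeps the
  limit normal with bounded level sets (\<open>kuratowski_limit_of_endographs\<close>). It also upgrades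
  Kuratowski convergence to convergence in \<open>H_end\<close>: a point of height at most \<open>e\<close> is within \<open>e\<close> of
  the hyperplane of height \<open>0\<close>, which all endographs contain, and the points of height above \<open>e\<close> lie
  in a bounded region, where points violating the distance bound would accumulate.

  Finally, the defining condition of each class passes to the limit: convex combinations and segments
  of approximating points converge to those of the limit points, and star centres stay in
  a bounded set, so they converge along a subsequence. Only for level-by-level star-shapedness
  is an extra step needed, since a point of height \<open>l\<close> is approximated by points that may have heights
  slightly below \<open>l\<close>: centres are first found at each level \<open>\<beta> < l\<close>, and then \<open>\<beta>\<close> tends to \<open>l\<close>.\<close>

section \<open>Hausdorff distance and bounded families\<close>

lemma hausdorff_edist_le:
  assumes "\<And>a. a \<in> A \<Longrightarrow> \<exists>b\<in>B. dist a b \<le> e" and "\<And>b. b \<in> B \<Longrightarrow> \<exists>a\<in>A. dist a b \<le> e"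
  shows "hausdorff_edist A B \<le> ennreal e"
  unfolding hausdorff_edist_def
proof (rule max.boundedI; rule SUP_least)
  show "(INF b\<in>B. ennreal (dist a b)) \<le> ennreal e" if "a \<in> A" for a
    using assms(1)[OF that] by (auto intro: INF_lower2 ennreal_leI)
  show "(INF a\<in>A. ennreal (dist a b)) \<le> ennreal e" if "b \<in> B" for b
    using assms(2)[OF that] by (auto intro: INF_lower2 ennreal_leI)
qed

lemma hausdorff_dist_le:
  assumes "0 \<le> e"
    and "\<And>a. a \<in> A \<Longrightarrow> \<exists>b\<in>B. dist a b \<le> e" and "\<And>b. b \<in> B \<Longrightarrow> \<exists>a\<in>A. dist a b \<le> e"
  shows "hausdorff_dist A B \<le> e"
  unfolding hausdorff_dist_def
  by (rule enn2real_leI) (auto intro!: assms hausdorff_edist_le)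

lemma hausdorff_dist_lessD:
  assumes "hausdorff_edist A B < top" "hausdorff_dist A B < e" "a \<in> A"
  shows "\<exists>b\<in>B. dist a b < e"
proof -
  have "(INF b\<in>B. ennreal (dist a b)) \<le> hausdorff_edist A B"
    unfolding hausdorff_edist_def using assms(3) by (intro max.coboundedI1 SUP_upper)
  also have "\<dots> < ennreal e"
    using assms(1,2) unfolding hausdorff_dist_def
    by (metis enn2real_nonneg ennreal_enn2real ennreal_lessI order_le_less_trans)
  finally show ?thesis by (auto simp: INF_less_iff ennreal_less_iff)
qed

lemma bounded_metric_neighbourhood:
  assumes "bounded B"
  shows "bounded {x. \<exists>y\<in>B. dist x y < e}"
proof -
  obtain c R where R: "\<And>y. y \<in> B \<Longrightarrow> dist c y \<le> R"
    using assms unfolding bounded_def by blast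
  have "dist c x \<le> R + e" if "y \<in> B" "dist x y < e" for x y
    using R[OF that(1)] that(2) dist_triangle[of c x y] by (simp add: dist_commute)
  then show ?thesis unfolding bounded_def by blast
qed

lemma hausdorff_edist_bounded_finite:
  assumes "bounded A" "A \<noteq> {}" "bounded B" "B \<noteq> {}"
  shows "hausdorff_edist A B < top"
proof -
  have "bounded (A \<union> B)" using assms by simp
  then obtain D where D: "\<And>x y. x \<in> A \<union> B \<Longrightarrow> y \<in> A \<union> B \<Longrightarrow> dist x y \<le> D"
    unfolding bounded_two_points by blast
  have "hausdorff_edist A B \<le> ennreal D"
  proof (rule hausdorff_edist_le)
    show "\<exists>b\<in>B. dist a b \<le> D" if "a \<in> A" for a using D[of a] that assms(4) by blast
    show "\<exists>a\<in>A. dist a b \<le> D" if "b \<in> B" for b using D[of _ b] that assms(2) by blast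
  qed
  then show ?thesis by (simp add: le_less_trans)
qed

text \<open>All sets of a Hausdorff-bounded family lie in a bounded neighbourhood of any one of them,
  and the Hausdorff distance of two nonempty sets is at most the diameter of their union. So the
  notion does not depend on the space of compact sets in which it is read.\<close>

lemma mbounded_hausdorff_iff:
  fixes M :: "(real ^ 'm::finite) set set"
  assumes "Metric_space M hausdorff_dist" "M \<subseteq> compact_sets" "S \<subseteq> M"
  shows "Metric_space.mbounded M hausdorff_dist S \<longleftrightarrow> bounded (\<Union>S)"
proof -
  interpret Metric_space M hausdorff_dist by fact
  have S: "bounded K" "K \<noteq> {}" if "K \<in> S" for K
    using that assms by (auto simp: compact_sets_def compact_imp_bounded)
  show ?thesis
  proof
    assume "mbounded S"
    then obtain B where B: "\<And>K L. K \<in> S \<Longrightarrow> L \<in> S \<Longrightarrow> hausdorff_dist K L \<le> B"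
      unfolding mbounded_alt by blast
    show "bounded (\<Union>S)"
    proof (cases "S = {}")
      case False
      then obtain K where K: "K \<in> S" by blast
      have "\<exists>y\<in>K. dist x y < B + 1" if "x \<in> L" "L \<in> S" for x L
      proof (rule hausdorff_dist_lessD)
        show "hausdorff_edist L K < top"
          using S that(2) K by (intro hausdorff_edist_bounded_finite) blast+
        show "hausdorff_dist L K < B + 1" using B[OF that(2) K] by simp
      qed (rule that(1))
      then show ?thesis
        by (intro bounded_subset[OF bounded_metric_neighbourhood[OF S(1)[OF K], of "B + 1"]]) blast
    qed simp
  next
    assume "bounded (\<Union>S)"
    then obtain D where D: "\<And>x y. x \<in> \<Union>S \<Longrightarrow> y \<in> \<Union>S \<Longrightarrow> dist x y \<le> D"
      unfolding bounded_two_points by blast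
    have "hausdorff_dist K L \<le> max D 0" if "K \<in> S" "L \<in> S" for K L
    proof (rule hausdorff_dist_le)
      have near: "dist a b \<le> max D 0" if "a \<in> K" "b \<in> L" for a b
        using D[of a b] that \<open>K \<in> S\<close> \<open>L \<in> S\<close> by (intro max.coboundedI1) blast
      obtain k l where kl: "k \<in> K" "l \<in> L" using S(2)[OF \<open>K \<in> S\<close>] S(2)[OF \<open>L \<in> S\<close>] by blast
      show "\<exists>b\<in>L. dist a b \<le> max D 0" if "a \<in> K" for a
        using near[OF that kl(2)] kl(2) by blast
      show "\<exists>a\<in>K. dist a b \<le> max D 0" if "b \<in> L" for b
        using near[OF kl(1) that] kl(1) by blast
    qed simp
    then show "mbounded S" using assms(3) unfolding mbounded_alt by blast
  qed
qed

section \<open>Kuratowski limits of sequences of sets\<close>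

text \<open>The first clause puts the set inside the lower limit of the sequence, the second makes it contain the
  upper limit, i.e. all accumulation points. As the lower limit is always contained in the upper limit,
  the two clauses together say that both limits are equal to the set.\<close>

definition kuratowski_limit :: "(nat \<Rightarrow> 'a::metric_space set) \<Rightarrow> 'a set \<Rightarrow> bool" where
  "kuratowski_limit A C \<longleftrightarrow>
     (\<forall>p\<in>C. \<exists>q. (\<forall>n. q n \<in> A n) \<and> q \<longlonglongrightarrow> p) \<and>
     (\<forall>r q p. strict_mono r \<longrightarrow> (\<forall>n. q n \<in> A (r n)) \<longrightarrow> q \<longlonglongrightarrow> p \<longrightarrow> p \<in> C)"

lemma kuratowski_limit_lowerE:
  assumes "kuratowski_limit A C" "p \<in> C"
  obtains q where "\<And>n. q n \<in> A n" "q \<longlonglongrightarrow> p"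
  using assms unfolding kuratowski_limit_def by blast

text \<open>The inclusion of the upper limit for points that lie in the sets only from some index on: a shifted
  subsequence is again a subsequence.\<close>

lemma kuratowski_limit_upper:
  assumes "kuratowski_limit A C" "strict_mono r" "\<forall>\<^sub>F n in sequentially. q n \<in> A (r n)" "q \<longlonglongrightarrow> p"
  shows "p \<in> C"
proof -
  obtain N where N: "\<And>n. n \<ge> N \<Longrightarrow> q n \<in> A (r n)"
    using assms(3) unfolding eventually_sequentially by blast
  have "strict_mono (\<lambda>n. r (n + N))" using assms(2) by (simp add: strict_mono_def)
  moreover have "\<forall>n. q (n + N) \<in> A (r (n + N))" using N by simp
  moreover have "(\<lambda>n. q (n + N)) \<longlonglongrightarrow> p" using assms(4) by (rule LIMSEQ_ignore_initial_segment)
  ultimately show ?thesis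
    using assms(1)[unfolded kuratowski_limit_def, THEN conjunct2, rule_format,
        of "\<lambda>n. r (n + N)" "\<lambda>n. q (n + N)" p] by simp
qed

text \<open>Choosing in each set a nearest point up to an error \<open>1 / (n + 1)\<close> turns convergence of the distances
  into convergence of one sequence of points.\<close>

lemma approximating_sequence:
  fixes p :: "'a::metric_space"
  assumes "\<And>n. A n \<noteq> {}" and "\<And>e. e > 0 \<Longrightarrow> \<forall>\<^sub>F n in sequentially. \<exists>q\<in>A n. dist q p < e"
  obtains q where "\<And>n. q n \<in> A n" "q \<longlonglongrightarrow> p"
proof -
  have "\<exists>q\<in>A n. dist p q < infdist p (A n) + 1 / Suc n" for n
  proof (rule ccontr)
    assume "\<not> ?thesis"
    then have "infdist p (A n) + 1 / Suc n \<le> infdist p (A n)"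
      using assms(1) by (subst (2) infdist_notempty) (auto intro!: cINF_greatest simp: not_less)
    then show False by simp
  qed
  then obtain q where q: "\<And>n. q n \<in> A n" "\<And>n. dist p (q n) < infdist p (A n) + 1 / Suc n"
    by metis
  have "q \<longlonglongrightarrow> p"
    unfolding tendsto_iff
  proof (intro allI impI)
    fix e :: real assume "e > 0"
    have "\<forall>\<^sub>F n in sequentially. 1 / real (Suc n) < e / 2"
      using \<open>e > 0\<close> LIMSEQ_Suc[OF lim_1_over_n] by (intro order_tendstoD) auto
    with assms(2)[of "e / 2"] have "\<forall>\<^sub>F n in sequentially.
        (\<exists>q\<in>A n. dist q p < e / 2) \<and> 1 / real (Suc n) < e / 2"
      using \<open>e > 0\<close> by (simp add: eventually_conj)
    then show "\<forall>\<^sub>F n in sequentially. dist (q n) p < e"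
    proof eventually_elim
      case (elim n)
      then obtain a where "a \<in> A n" "dist p a < e / 2" by (auto simp: dist_commute)
      then have "infdist p (A n) < e / 2" using infdist_le[of a "A n" p] by linarith
      with q(2)[of n] elim show ?case by (simp add: dist_commute)
    qed
  qed
  with q(1) that show ?thesis by blast
qed

text \<open>A point in the closure is approached, up to any error, by points of all late sets \<open>A n\<close>, so it
  already is the limit of a sequence of such points.\<close>

lemma closed_kuratowski_limit:
  assumes "kuratowski_limit A C" "\<And>n. A n \<noteq> {}"
  shows "closed C"
proof -
  have "p \<in> C" if p: "p \<in> closure C" for p
  proof -
    have "\<forall>\<^sub>F n in sequentially. \<exists>q\<in>A n. dist q p < e" if "e > 0" for e
    proof -
      obtain c where c: "c \<in> C" "dist c p < e / 2"
        using p \<open>e > 0\<close> unfolding closure_approachable by (meson half_gt_zero)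
      obtain q where q: "\<And>n. q n \<in> A n" "q \<longlonglongrightarrow> c"
        using kuratowski_limit_lowerE[OF assms(1) c(1)] by blast
      have "\<forall>\<^sub>F n in sequentially. dist (q n) c < e / 2"
        using tendstoD[OF q(2), of "e / 2"] \<open>e > 0\<close> by simp
      then show ?thesis
      proof eventually_elim
        case (elim n)
        then have "dist (q n) p < e" using c(2) dist_triangle[of "q n" p c] by linarith
        then show ?case using q(1) by blast
      qed
    qed
    then obtain q where "\<And>n. q n \<in> A n" "q \<longlonglongrightarrow> p"
      using approximating_sequence[of A p] assms(2) by blast
    then show "p \<in> C"
      using kuratowski_limit_upper[OF assms(1), of id q p] by (simp add: strict_mono_id)
  qed
  then show ?thesis by (metis closure_subset closure_eq subsetI subset_antisym)
qed

text \<open>For one predicate, either it eventually fails or it holds on a whole subsequence; diagonalisation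
  treats countably many predicates at once.\<close>

lemma ex_subseq_deciding_predicates:
  fixes Q :: "nat \<Rightarrow> nat \<Rightarrow> bool"
  obtains r where "strict_mono r"
    "\<And>k. (\<forall>\<^sub>F n in sequentially. Q k (r n)) \<or> (\<forall>\<^sub>F n in sequentially. \<not> Q k (r n))"
proof -
  define P where "P = (\<lambda>k s. (\<forall>\<^sub>F n in sequentially. Q k (s n)) \<or> (\<forall>\<^sub>F n in sequentially. \<not> Q k (s n)))"
  interpret subseqs P
  proof
    fix k and s :: "nat \<Rightarrow> nat" assume "strict_mono s"
    show "\<exists>r'. strict_mono r' \<and> P k (s \<circ> r')"
    proof (cases "\<forall>\<^sub>F n in sequentially. \<not> Q k (s n)")
      case True
      then show ?thesis by (intro exI[of _ id]) (simp add: P_def strict_mono_id)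
    next
      case False
      then obtain r' :: "nat \<Rightarrow> nat" where "strict_mono r'" "\<And>n. Q k (s (r' n))"
        using not_eventually_sequentiallyD by fastforce
      then show ?thesis by (auto simp: P_def)
    qed
  qed
  have "P k diagseq" for k
  proof -
    have "P k (diagseq \<circ> ((+) (Suc k)))"
    proof (rule diagseq_holds)
      show "P n (s \<circ> r)" if "strict_mono r" "P n s" for r s n
        using that(2) eventually_subseq[OF that(1)] unfolding P_def o_def by fast
    qed
    moreover have "P k (s \<circ> ((+) m)) \<longleftrightarrow> P k s" for s m
      using eventually_sequentially_seg[of "\<lambda>n. Q k (s n)" m]
        eventually_sequentially_seg[of "\<lambda>n. \<not> Q k (s n)" m]
      by (simp add: P_def add.commute)
    ultimately show ?thesis by blast
  qed
  then show ?thesis using that subseq_diagseq unfolding P_def by blast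
qed

text \<open>Along a suitable subsequence, each set of a countable basis is either met by all late \<open>A n\<close> or by none
  of them. The limit consists of the points for which only the first case occurs in their basic
  neighbourhoods; an accumulation point cannot have a neighbourhood of the second kind.\<close>

lemma kuratowski_compactness:
  fixes A :: "nat \<Rightarrow> 'a::{metric_space, second_countable_topology} set"
  assumes "\<And>n. A n \<noteq> {}"
  obtains r C where "strict_mono r" "kuratowski_limit (\<lambda>n. A (r n)) C"
proof -
  obtain \<B> :: "'a set set" where \<B>: "countable \<B>" "topological_basis \<B>"
    using ex_countable_basis by blast
  have ne: "\<B> \<noteq> {}"
    using topological_basisE[OF \<B>(2) open_UNIV UNIV_I] by blast
  define b where "b = from_nat_into \<B>"
  have b: "range b = \<B>" using range_from_nat_into[OF ne \<B>(1)] by (simp add: b_def)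
  obtain r where r: "strict_mono r"
    and dec: "\<And>k. (\<forall>\<^sub>F n in sequentially. A (r n) \<inter> b k \<noteq> {}) \<or>
               (\<forall>\<^sub>F n in sequentially. \<not> (A (r n) \<inter> b k \<noteq> {}))"
    using ex_subseq_deciding_predicates[of "\<lambda>k n. A n \<inter> b k \<noteq> {}"] by blast
  define C where "C = {p. \<forall>k. p \<in> b k \<longrightarrow> (\<forall>\<^sub>F n in sequentially. A (r n) \<inter> b k \<noteq> {})}"
  have "kuratowski_limit (\<lambda>n. A (r n)) C"
    unfolding kuratowski_limit_def
  proof (intro conjI ballI allI impI)
    fix p assume p: "p \<in> C"
    have "\<forall>\<^sub>F n in sequentially. \<exists>q\<in>A (r n). dist q p < e" if "e > 0" for e
    proof -
      obtain B where "B \<in> \<B>" "p \<in> B" and B: "B \<subseteq> ball p e"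
        using topological_basisE[OF \<B>(2) open_ball] \<open>e > 0\<close> centre_in_ball by metis
      then obtain k where k: "B = b k" using b by blast
      have "\<forall>\<^sub>F n in sequentially. A (r n) \<inter> b k \<noteq> {}"
        using p \<open>p \<in> B\<close> k unfolding C_def by blast
      then show ?thesis
        by eventually_elim (use B k in \<open>fastforce simp: dist_commute\<close>)
    qed
    then obtain q where "\<And>n. q n \<in> A (r n)" "q \<longlonglongrightarrow> p"
      using approximating_sequence[of "\<lambda>n. A (r n)" p] assms by blast
    then show "\<exists>q. (\<forall>n. q n \<in> A (r n)) \<and> q \<longlonglongrightarrow> p" by blast
  next
    fix s :: "nat \<Rightarrow> nat" and q p
    assume s: "strict_mono s" and q: "\<forall>n. q n \<in> A (r (s n))" "q \<longlonglongrightarrow> p"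
    have "\<forall>\<^sub>F n in sequentially. A (r n) \<inter> b k \<noteq> {}" if p: "p \<in> b k" for k
    proof (rule ccontr)
      assume "\<not> ?thesis"
      then have "\<forall>\<^sub>F n in sequentially. A (r n) \<inter> b k = {}" using dec[of k] by simp
      then have "\<forall>\<^sub>F n in sequentially. A (r (s n)) \<inter> b k = {}"
        using eventually_subseq[OF s] by fast
      moreover have "\<forall>\<^sub>F n in sequentially. q n \<in> b k"
      proof (rule topological_tendstoD[OF q(2) _ p])
        show "open (b k)" using b \<B>(2) by (metis rangeI topological_basis_open)
      qed
      ultimately have "\<forall>\<^sub>F n in sequentially. False"
        by eventually_elim (use q(1) in blast)
      then show False by simp
    qed
    then show "p \<in> C" unfolding C_def by blast
  qed
  with r that show ?thesis by blast
qed

section \<open>Limits of fuzzy sets\<close>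

lemma upper_semicontinuous_iff_closed_level_sets:
  fixes u :: "'a::topological_space \<Rightarrow> real"
  shows
  "upper_semicontinuous u \<longleftrightarrow> (\<forall>a. closed (level_set u a))"
proof -
  have nhds: "open S \<longleftrightarrow> (\<forall>x\<in>S. \<forall>\<^sub>F y in nhds x. y \<in> S)" for S :: "'a set"
    by (subst open_subopen) (simp add: eventually_nhds subset_eq)
  have "upper_semicontinuous u \<longleftrightarrow> (\<forall>a. open {x. u x < a})"
    unfolding upper_semicontinuous_def nhds by auto
  moreover have "- level_set u a = {x. u x < a}" for a by (auto simp: level_set_def)
  ultimately show ?thesis by (simp add: closed_def)
qed

lemma fuzzy_base_range: "u \<in> fuzzy_base \<Longrightarrow> 0 \<le> u x" "u \<in> fuzzy_base \<Longrightarrow> u x \<le> 1"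
  by (auto simp: fuzzy_base_def)

lemma mem_endograph_iff: "(x, t) \<in> endograph u \<longleftrightarrow> 0 \<le> t \<and> t \<le> 1 \<and> t \<le> u x"
  by (auto simp: endograph_def)

lemma endograph_nonempty: "u \<in> fuzzy_base \<Longrightarrow> endograph u \<noteq> {}"
  using fuzzy_base_range(1) by (fastforce simp: endograph_def)

definition levelwise_bounded :: "('a::metric_space \<Rightarrow> real) set \<Rightarrow> bool" where
  "levelwise_bounded U \<longleftrightarrow> (\<forall>\<alpha>\<in>{0<..1}. bounded (\<Union>u\<in>U. level_set u \<alpha>))"

lemma levelwise_bounded_subset: "levelwise_bounded U \<Longrightarrow> V \<subseteq> U \<Longrightarrow> levelwise_bounded V"
  unfolding levelwise_bounded_def by (meson UN_mono bounded_subset order_refl)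

lemma levelwise_bounded_convergent_subseq:
  fixes U :: "('a::heine_borel \<Rightarrow> real) set"
  assumes "levelwise_bounded U" "0 < \<alpha>" "\<alpha> \<le> 1" "\<And>n. w n \<in> U" "\<And>n. \<alpha> \<le> w n (y n)"
  obtains x r where "strict_mono (r :: nat \<Rightarrow> nat)" "(\<lambda>n. y (r n)) \<longlonglongrightarrow> x"
proof -
  have "bounded (\<Union>u\<in>U. level_set u \<alpha>)" using assms(1-3) by (simp add: levelwise_bounded_def)
  moreover have "range y \<subseteq> (\<Union>u\<in>U. level_set u \<alpha>)" using assms(4,5) by (auto simp: level_set_def)
  ultimately have "bounded (range y)" by (rule bounded_subset)
  then show ?thesis
    using bounded_imp_convergent_subsequence that unfolding o_def by blast
qed

text \<open>The limit \<open>C\<close> is the endograph of the function that assigns to \<open>x\<close> the largest height over \<open>x\<close> in \<open>C\<close>.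
  Levelwise boundedness is used twice: points of height \<open>1\<close> do not escape to infinity, so the limit is
  normal, and a point of height \<open>\<alpha>\<close> in \<open>C\<close> is a limit of points in the
  \<open>\<alpha> / 2\<close>-level sets, which all lie in one bounded set.\<close>

lemma kuratowski_limit_of_endographs:
  fixes v :: "nat \<Rightarrow> real ^ 'm::finite \<Rightarrow> real"
  assumes v: "\<And>n. v n \<in> fuzzy_base" and bdd: "levelwise_bounded (range v)"
    and lim: "kuratowski_limit (\<lambda>n. endograph (v n)) C"
  obtains u where "u \<in> fuzzy_base" "C = endograph u"
proof -
  define u where "u x = Sup {t. (x, t) \<in> C}" for x
  have lower: thesis
    if xt: "(x, t) \<in> C" and "\<And>y s. y \<longlonglongrightarrow> x \<Longrightarrow> s \<longlonglongrightarrow> t \<Longrightarrow> (\<And>n. (y n, s n) \<in> endograph (v n)) \<Longrightarrow> thesis"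
    for x t thesis
  proof -
    obtain q where "\<And>n. q n \<in> endograph (v n)" "q \<longlonglongrightarrow> (x, t)"
      using kuratowski_limit_lowerE[OF lim xt] by blast
    then show thesis
      using that(2)[of "\<lambda>n. fst (q n)" "\<lambda>n. snd (q n)"] tendsto_fst tendsto_snd by fastforce
  qed
  have upper: "(x, t) \<in> C"
    if "strict_mono r" "y \<longlonglongrightarrow> x" "s \<longlonglongrightarrow> t" "\<And>n. (y n, s n) \<in> endograph (v (r n))" for r y s x t
    using kuratowski_limit_upper[OF lim that(1), of "\<lambda>n. (y n, s n)" "(x, t)"] that
    by (simp add: tendsto_Pair)
  have closed: "closed C"
    using closed_kuratowski_limit[OF lim] endograph_nonempty v by blast
  have zero: "(x, 0) \<in> C" for x
    by (rule upper[of id "\<lambda>_. x" x "\<lambda>_. 0" 0])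
      (simp_all add: strict_mono_id mem_endograph_iff fuzzy_base_range v)
  have range: "0 \<le> t \<and> t \<le> 1" if "(x, t) \<in> C" for x t
    using that
  proof (rule lower)
    fix y s assume "s \<longlonglongrightarrow> t" "\<And>n. (y n, s n) \<in> endograph (v n)"
    then show ?thesis
      by (auto simp: mem_endograph_iff intro: LIMSEQ_le_const LIMSEQ_le_const2)
  qed
  have down: "(x, t') \<in> C" if "(x, t) \<in> C" "0 \<le> t'" "t' \<le> t" for x t t'
    using that(1)
  proof (rule lower)
    fix y s assume s: "y \<longlonglongrightarrow> x" "s \<longlonglongrightarrow> t" "\<And>n. (y n, s n) \<in> endograph (v n)"
    have "(\<lambda>n. min t' (s n)) \<longlonglongrightarrow> t'"
      using tendsto_min[OF tendsto_const s(2), of t'] that by simp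
    then show ?thesis
      by (rule upper[of id, OF strict_mono_id s(1)])
        (use s(3) that in \<open>auto simp: mem_endograph_iff min_le_iff_disj\<close>)
  qed
  have sup: "(x, u x) \<in> C" for x
  proof -
    have "closed {t. (x, t) \<in> C}"
    proof -
      have "closed ((\<lambda>t. (x, t)) -` C)"
        by (intro closed_vimage closed continuous_intros)
      then show ?thesis by (simp add: vimage_def)
    qed
    moreover have "bdd_above {t. (x, t) \<in> C}" using range by (auto intro: bdd_aboveI[of _ 1])
    ultimately show ?thesis
      using closed_contains_Sup[of "{t. (x, t) \<in> C}"] zero unfolding u_def by blast
  qed
  have mem: "(x, t) \<in> C \<longleftrightarrow> 0 \<le> t \<and> t \<le> u x" for x t
  proof
    assume "(x, t) \<in> C"
    moreover have "bdd_above {t. (x, t) \<in> C}" using range by (auto intro: bdd_aboveI[of _ 1])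
    ultimately show "0 \<le> t \<and> t \<le> u x" using range unfolding u_def by (auto intro: cSup_upper)
  qed (use down sup in blast)
  have u01: "0 \<le> u x" "u x \<le> 1" for x using range[OF sup] by auto
  have "closed (level_set u a)" for a
  proof (cases "a \<le> 0")
    case True
    then have "level_set u a = UNIV" using u01(1) by (auto simp: level_set_def intro: order_trans)
    then show ?thesis by simp
  next
    case False
    then have "level_set u a = (\<lambda>x. (x, a)) -` C" by (auto simp: level_set_def mem)
    moreover have "closed ((\<lambda>x. (x, a)) -` C)"
      by (intro closed_vimage closed continuous_intros)
    ultimately show ?thesis by simp
  qed
  then have "upper_semicontinuous u" by (simp add: upper_semicontinuous_iff_closed_level_sets)
  moreover have "\<exists>x. u x = 1"
  proof -
    have "\<exists>x. v n x = 1" for n using v by (auto simp: fuzzy_base_def)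
    then obtain c where c: "\<And>n. v n (c n) = 1" by metis
    have "1 \<le> v n (c n)" for n by (simp add: c)
    then obtain x r where r: "strict_mono (r :: nat \<Rightarrow> nat)" "(\<lambda>n. c (r n)) \<longlonglongrightarrow> x"
      by (rule levelwise_bounded_convergent_subseq[OF bdd zero_less_one order_refl rangeI])
    have "(x, 1) \<in> C"
      by (rule upper[OF r, of "\<lambda>_. 1"]) (simp_all add: mem_endograph_iff c)
    then show ?thesis using mem u01 by (metis antisym)
  qed
  moreover have "bounded (level_set u \<alpha>)" if \<alpha>: "0 < \<alpha>" "\<alpha> \<le> 1" for \<alpha>
  proof -
    have "x \<in> closure (\<Union>n. level_set (v n) (\<alpha> / 2))" if "\<alpha> \<le> u x" for x
    proof -
      have "(x, \<alpha>) \<in> C" using that \<alpha> by (simp add: mem)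
      then show ?thesis
      proof (rule lower)
        fix y s assume s: "y \<longlonglongrightarrow> x" "s \<longlonglongrightarrow> \<alpha>" "\<And>n. (y n, s n) \<in> endograph (v n)"
        have "\<forall>\<^sub>F n in sequentially. \<alpha> / 2 < s n" using \<alpha> by (intro order_tendstoD[OF s(2)]) simp
        then have "\<forall>\<^sub>F n in sequentially. y n \<in> closure (\<Union>n. level_set (v n) (\<alpha> / 2))"
        proof eventually_elim
          case (elim n)
          then have "y n \<in> level_set (v n) (\<alpha> / 2)"
            using s(3)[of n] by (simp add: mem_endograph_iff level_set_def)
          then show ?case by (intro subsetD[OF closure_subset]) blast
        qed
        then show ?thesis
          by (rule Lim_in_closed_set[OF closed_closure _ _ s(1)]) simp
      qed
    qed
    moreover have "bounded (closure (\<Union>n. level_set (v n) (\<alpha> / 2)))"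
      using bdd \<alpha> by (auto simp: levelwise_bounded_def intro!: bounded_closure)
    ultimately show ?thesis by (auto simp: level_set_def intro: bounded_subset)
  qed
  ultimately have "u \<in> fuzzy_base" using u01 by (simp add: fuzzy_base_def)
  moreover have "C = endograph u"
  proof -
    have "p \<in> C \<longleftrightarrow> p \<in> endograph u" for p
      using mem u01 by (cases p) (auto simp: mem_endograph_iff intro: order_trans)
    then show ?thesis by blast
  qed
  ultimately show ?thesis using that by blast
qed

text \<open>Kuratowski convergence of a levelwise bounded sequence of fuzzy sets. The level bounds supply the
  compactness that makes this convergence as strong as convergence in \<open>H_end\<close>.\<close>

locale endograph_limit =
  fixes v :: "nat \<Rightarrow> real ^ 'm::finite \<Rightarrow> real" and u :: "real ^ 'm \<Rightarrow> real"
  assumes v: "\<And>n. v n \<in> fuzzy_base" and u: "u \<in> fuzzy_base"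
    and bdd: "levelwise_bounded (range v)"
    and lim: "kuratowski_limit (\<lambda>n. endograph (v n)) (endograph u)"
begin

lemma lowerE:
  assumes "0 \<le> t" "t \<le> u x"
  obtains y s where "y \<longlonglongrightarrow> x" "s \<longlonglongrightarrow> t" "\<And>n. 0 \<le> s n" "\<And>n. s n \<le> 1" "\<And>n. s n \<le> v n (y n)"
proof -
  have "t \<le> 1" using assms(2) fuzzy_base_range(2)[OF u] by (rule order_trans)
  then have "(x, t) \<in> endograph u" using assms by (simp add: mem_endograph_iff)
  then obtain q where q: "\<And>n. q n \<in> endograph (v n)" "q \<longlonglongrightarrow> (x, t)"
    using kuratowski_limit_lowerE[OF lim] by blast
  have "(fst (q n), snd (q n)) \<in> endograph (v n)" for n using q(1) by simp
  then show ?thesis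
    using that[of "\<lambda>n. fst (q n)" "\<lambda>n. snd (q n)"] tendsto_fst[OF q(2)] tendsto_snd[OF q(2)]
    unfolding mem_endograph_iff by simp
qed

lemma upper:
  assumes "strict_mono r" "y \<longlonglongrightarrow> x" "s \<longlonglongrightarrow> t"
    and "\<forall>\<^sub>F n in sequentially. 0 \<le> s n \<and> s n \<le> v (r n) (y n)"
  shows "t \<le> u x"
proof -
  have "(x, t) \<in> endograph u"
  proof (rule kuratowski_limit_upper[OF lim assms(1)])
    show "\<forall>\<^sub>F n in sequentially. (y n, s n) \<in> endograph (v (r n))"
      using assms(4) by eventually_elim
        (auto simp: mem_endograph_iff intro: order_trans[OF _ fuzzy_base_range(2)[OF v]])
  qed (intro tendsto_Pair assms)
  then show ?thesis by (simp add: mem_endograph_iff)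
qed

lemma convergent_subseq:
  assumes "0 < \<alpha>" "\<alpha> \<le> 1" "\<And>n. \<alpha> \<le> v (r n) (y n)"
  obtains x r' where "strict_mono (r' :: nat \<Rightarrow> nat)" "(\<lambda>n. y (r' n)) \<longlonglongrightarrow> x"
  using levelwise_bounded_convergent_subseq[OF bdd assms(1,2), of "\<lambda>n. v (r n)" y] assms(3) by blast

text \<open>Points of the endographs of \<open>v n\<close> that stay farther than \<open>e\<close> from the endograph of \<open>u\<close> have heights
  above \<open>e\<close>, so they lie in a bounded region and accumulate at a point of the limit, which is absurd.\<close>

lemma excess_to_limit:
  assumes "e > 0"
  shows "\<forall>\<^sub>F n in sequentially. \<forall>p\<in>endograph (v n). \<exists>q\<in>endograph u. dist p q \<le> e"
proof (rule ccontr)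
  assume "\<not> ?thesis"
  then obtain r :: "nat \<Rightarrow> nat" where r: "strict_mono r"
    and "\<And>n. \<exists>p\<in>endograph (v (r n)). \<forall>q\<in>endograph u. \<not> dist p q \<le> e"
    using not_eventually_sequentiallyD by fastforce
  then obtain p where p: "\<And>n. p n \<in> endograph (v (r n))"
    and far: "\<And>n q. q \<in> endograph u \<Longrightarrow> e < dist (p n) q"
    by (metis not_le)
  define y s where "y n = fst (p n)" and "s n = snd (p n)" for n
  have ys: "0 \<le> s n" "s n \<le> 1" "s n \<le> v (r n) (y n)" for n
    using p[of n] unfolding y_def s_def by (metis prod.collapse mem_endograph_iff)+
  have es: "e < s n" for n
  proof -
    have "(y n, 0) \<in> endograph u" using fuzzy_base_range[OF u] by (simp add: mem_endograph_iff)
    from far[OF this, of n] show ?thesis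
      using ys(1)[of n] by (simp add: dist_prod_def y_def s_def)
  qed
  then have "e \<le> 1" "\<And>n. e \<le> v (r n) (y n)" using ys less_imp_le order_trans by metis+
  then obtain x r1 where r1: "strict_mono r1" "(\<lambda>n. y (r1 n)) \<longlonglongrightarrow> x"
    using convergent_subseq[OF assms] by blast
  have "bounded (range (\<lambda>n. s (r1 n)))"
    by (rule boundedI[of _ 1]) (use ys in auto)
  then obtain t r2 where r2: "strict_mono (r2 :: nat \<Rightarrow> nat)" "(\<lambda>n. s (r1 (r2 n))) \<longlonglongrightarrow> t"
    using bounded_imp_convergent_subsequence unfolding o_def by blast
  have y2: "(\<lambda>n. y (r1 (r2 n))) \<longlonglongrightarrow> x"
    using LIMSEQ_subseq_LIMSEQ[OF r1(2) r2(1)] by (simp add: o_def)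
  have "t \<le> u x"
    by (rule upper[OF _ y2 r2(2), of "\<lambda>n. r (r1 (r2 n))"])
      (use r r1(1) r2(1) ys in \<open>auto simp: strict_mono_def\<close>)
  moreover have "0 \<le> t" "t \<le> 1"
    using r2(2) ys by (auto intro: LIMSEQ_le_const LIMSEQ_le_const2)
  ultimately have "(x, t) \<in> endograph u" by (simp add: mem_endograph_iff)
  moreover have "(\<lambda>n. p (r1 (r2 n))) \<longlonglongrightarrow> (x, t)"
    using tendsto_Pair[OF y2 r2(2)] by (simp add: y_def s_def)
  then have "\<forall>\<^sub>F n in sequentially. dist (p (r1 (r2 n))) (x, t) < e" using assms by (rule tendstoD)
  then obtain n where "dist (p (r1 (r2 n))) (x, t) < e"
    unfolding eventually_sequentially by blast
  ultimately show False using far[of "(x, t)" "r1 (r2 n)"] by simp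
qed

text \<open>The same argument in the other direction takes place in the compact part of height at least \<open>e\<close> of
  the endograph of \<open>u\<close>; an accumulation point there is a limit of points of the endographs of \<open>v n\<close>.\<close>

lemma excess_from_limit:
  assumes "e > 0"
  shows "\<forall>\<^sub>F n in sequentially. \<forall>p\<in>endograph u. \<exists>q\<in>endograph (v n). dist p q \<le> e"
proof (rule ccontr)
  assume "\<not> ?thesis"
  then obtain r :: "nat \<Rightarrow> nat" where r: "strict_mono r"
    and "\<And>n. \<exists>p\<in>endograph u. \<forall>q\<in>endograph (v (r n)). \<not> dist p q \<le> e"
    using not_eventually_sequentiallyD by fastforce
  then obtain p where p: "\<And>n. p n \<in> endograph u"
    and far: "\<And>n q. q \<in> endograph (v (r n)) \<Longrightarrow> e < dist (p n) q"
    by (metis not_le)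
  define y s where "y n = fst (p n)" and "s n = snd (p n)" for n
  have ys: "0 \<le> s n" "s n \<le> 1" "s n \<le> u (y n)" for n
    using p[of n] unfolding y_def s_def by (metis prod.collapse mem_endograph_iff)+
  have es: "e < s n" for n
  proof -
    have "(y n, 0) \<in> endograph (v (r n))"
      using fuzzy_base_range[OF v] by (simp add: mem_endograph_iff)
    from far[OF this] show ?thesis
      using ys(1)[of n] by (simp add: dist_prod_def y_def s_def)
  qed
  then have e: "e \<le> 1" "\<And>n. e \<le> u (y n)" using ys less_imp_le order_trans by metis+
  have "bounded (level_set u e \<times> {0..1::real})"
    using u assms e(1) by (intro bounded_Times) (auto simp: fuzzy_base_def)
  moreover have "range p \<subseteq> level_set u e \<times> {0..1}"
  proof -
    have "p n = (y n, s n)" for n by (simp add: y_def s_def)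
    then show ?thesis using e ys by (auto simp: level_set_def)
  qed
  ultimately have "bounded (range p)" by (rule bounded_subset)
  then obtain c r1 where r1: "strict_mono (r1 :: nat \<Rightarrow> nat)" "(\<lambda>n. p (r1 n)) \<longlonglongrightarrow> c"
    using bounded_imp_convergent_subsequence unfolding o_def by blast
  have "upper_semicontinuous u" using u by (simp add: fuzzy_base_def)
  then have "c \<in> endograph u"
    using closed_endograph closed_sequentially p r1(2) by metis
  then obtain q where q: "\<And>n. q n \<in> endograph (v n)" "q \<longlonglongrightarrow> c"
    using kuratowski_limit_lowerE[OF lim] by blast
  have "strict_mono (\<lambda>n. r (r1 n))" using r r1(1) by (simp add: strict_mono_def)
  then have "(\<lambda>n. q (r (r1 n))) \<longlonglongrightarrow> c" using LIMSEQ_subseq_LIMSEQ[OF q(2)] by (simp add: o_def)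
  from tendsto_dist[OF r1(2) this] have "(\<lambda>n. dist (p (r1 n)) (q (r (r1 n)))) \<longlonglongrightarrow> 0" by simp
  then have "\<forall>\<^sub>F n in sequentially. dist (p (r1 n)) (q (r (r1 n))) < e"
    using assms by (rule order_tendstoD)
  then obtain n where "dist (p (r1 n)) (q (r (r1 n))) < e"
    unfolding eventually_sequentially by blast
  then show False using far[OF q(1), of "r1 n"] by simp
qed

lemma H_end_tendsto_zero: "(\<lambda>n. H_end (v n) u) \<longlonglongrightarrow> 0"
proof (rule tendstoI)
  fix e :: real assume "e > 0"
  then have "e / 2 > 0" by simp
  from excess_to_limit[OF this] excess_from_limit[OF this]
  show "\<forall>\<^sub>F n in sequentially. dist (H_end (v n) u) 0 < e"
  proof eventually_elim
    case (elim n)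
    have "H_end (v n) u \<le> e / 2"
      unfolding H_end_def
    proof (rule hausdorff_dist_le)
      show "\<exists>b\<in>endograph u. dist a b \<le> e / 2" if "a \<in> endograph (v n)" for a
        using elim(1) that by blast
      show "\<exists>a\<in>endograph (v n). dist a b \<le> e / 2" if "b \<in> endograph u" for b
        using elim(2) that by (metis dist_commute)
    qed (use \<open>e > 0\<close> in simp)
    moreover have "0 \<le> H_end (v n) u" by (simp add: H_end_def hausdorff_dist_def)
    ultimately show ?case using \<open>e > 0\<close> by simp
  qed
qed

text \<open>Two points of the limit at the common height \<open>min (u x) (u y)\<close> are approximated by points whose
  convex combinations lie in the approximating endographs and converge to the desired point.\<close>

lemma limit_in_E_nc:
  assumes "\<And>n. v n \<in> E_nc"
  shows "u \<in> E_nc"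
proof -
  have "min (u x) (u y) \<le> u (l *\<^sub>R x + (1 - l) *\<^sub>R y)" if l: "l \<in> {0..1}" for x y l
  proof -
    define t where "t = min (u x) (u y)"
    have t: "0 \<le> t" "t \<le> u x" "t \<le> u y" using fuzzy_base_range[OF u] by (auto simp: t_def)
    obtain a s where a: "a \<longlonglongrightarrow> x" "s \<longlonglongrightarrow> t" "\<And>n. 0 \<le> s n" "\<And>n. s n \<le> v n (a n)"
      using lowerE[OF t(1,2)] by metis
    obtain b s' where b: "b \<longlonglongrightarrow> y" "s' \<longlonglongrightarrow> t" "\<And>n. 0 \<le> s' n" "\<And>n. s' n \<le> v n (b n)"
      using lowerE[OF t(1,3)] by metis
    have "min (s n) (s' n) \<le> v n (l *\<^sub>R a n + (1 - l) *\<^sub>R b n)" for n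
    proof -
      have "min (s n) (s' n) \<le> min (v n (a n)) (v n (b n))" using a(4) b(4) by (intro min.mono)
      also have "\<dots> \<le> v n (l *\<^sub>R a n + (1 - l) *\<^sub>R b n)"
        using assms[of n] l unfolding E_nc_def by blast
      finally show ?thesis .
    qed
    moreover have "(\<lambda>n. min (s n) (s' n)) \<longlonglongrightarrow> t" using tendsto_min[OF a(2) b(2)] by simp
    moreover have "(\<lambda>n. l *\<^sub>R a n + (1 - l) *\<^sub>R b n) \<longlonglongrightarrow> l *\<^sub>R x + (1 - l) *\<^sub>R y"
      by (intro tendsto_intros a b)
    ultimately show ?thesis
      using upper[of id "\<lambda>n. l *\<^sub>R a n + (1 - l) *\<^sub>R b n" _ "\<lambda>n. min (s n) (s' n)" t] a(3) b(3)
      by (simp add: strict_mono_id t_def)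
  qed
  then show ?thesis using u by (simp add: E_nc_def)
qed

text \<open>A star centre of \<open>v n\<close> has height \<open>1\<close>, because the segment from a point of height \<open>1\<close> leads to
  it. So the centres are bounded, and any accumulation point is a star centre of the limit.\<close>

lemma limit_in_S_nc:
  assumes "\<And>n. v n \<in> S_nc"
  shows "u \<in> S_nc"
proof -
  have "\<exists>x. \<forall>y. \<forall>l\<in>{0..1}. v n y \<le> v n (l *\<^sub>R y + (1 - l) *\<^sub>R x)" for n
    using assms unfolding S_nc_def by blast
  then obtain c where c: "\<And>n y l. l \<in> {0..1} \<Longrightarrow> v n y \<le> v n (l *\<^sub>R y + (1 - l) *\<^sub>R c n)"
    by metis
  have "1 \<le> v (id n) (c n)" for n
  proof -
    obtain x0 where "v n x0 = 1" using v[of n] unfolding fuzzy_base_def by blast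
    then show ?thesis using c[of 0 n x0] by simp
  qed
  then obtain x r where r: "strict_mono r" "(\<lambda>n. c (r n)) \<longlonglongrightarrow> x"
    using convergent_subseq[OF zero_less_one order_refl, of id c] by blast
  have "u y \<le> u (l *\<^sub>R y + (1 - l) *\<^sub>R x)" if l: "l \<in> {0..1}" for y l
  proof -
    obtain b s where b: "b \<longlonglongrightarrow> y" "s \<longlonglongrightarrow> u y" "\<And>n. 0 \<le> s n" "\<And>n. s n \<le> v n (b n)"
      using lowerE[OF fuzzy_base_range(1)[OF u] order_refl] by metis
    have "(\<lambda>n. b (r n)) \<longlonglongrightarrow> y" "(\<lambda>n. s (r n)) \<longlonglongrightarrow> u y"
      using LIMSEQ_subseq_LIMSEQ[OF _ r(1)] b(1,2) by (auto simp: o_def)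
    moreover have "s n \<le> v n (l *\<^sub>R b n + (1 - l) *\<^sub>R c n)" for n
      using b(4) c[OF l] by (rule order_trans)
    ultimately show ?thesis
      using upper[OF r(1), of "\<lambda>n. l *\<^sub>R b (r n) + (1 - l) *\<^sub>R c (r n)" _ "\<lambda>n. s (r n)"] b(3) r(2)
      by (simp add: tendsto_add tendsto_scaleR)
  qed
  then show ?thesis using u unfolding S_nc_def by blast
qed

text \<open>A point of \<open>[u]\<^sub>l\<close> is a limit of points whose heights tend to \<open>l\<close>, but may stay below it, so
  they are only known to lie in \<open>[v n]\<^sub>\<beta>\<close> for \<open>\<beta> < l\<close>. Accumulation points of star centres of these
  sets then serve all of \<open>[u]\<^sub>l\<close>, with segments in \<open>[u]\<^sub>\<beta>\<close>.\<close>

lemma limit_level_set_star_below: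
  assumes "\<And>n. v n \<in> S_tilde_nc" "0 < \<beta>" "\<beta> < l" "l \<le> 1"
  shows "\<exists>x\<in>level_set u \<beta>. \<forall>y\<in>level_set u l. closed_segment x y \<subseteq> level_set u \<beta>"
proof -
  have "\<exists>x\<in>level_set (v n) \<beta>. \<forall>y\<in>level_set (v n) \<beta>. closed_segment x y \<subseteq> level_set (v n) \<beta>" for n
    using assms unfolding S_tilde_nc_def by force
  then obtain c where c: "\<And>n. c n \<in> level_set (v n) \<beta>"
    "\<And>n y. y \<in> level_set (v n) \<beta> \<Longrightarrow> closed_segment (c n) y \<subseteq> level_set (v n) \<beta>"
    by metis
  have cv: "\<beta> \<le> v (id n) (c n)" for n using c(1) by (simp add: level_set_def)
  have "\<beta> \<le> 1" using assms(3,4) by simp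
  then obtain x r where r: "strict_mono (r :: nat \<Rightarrow> nat)" "(\<lambda>n. c (r n)) \<longlonglongrightarrow> x"
    by (rule convergent_subseq[of \<beta> id c, OF assms(2) _ cv])
  have "\<beta> \<le> u x"
    by (rule upper[OF r tendsto_const]) (use assms cv in auto)
  moreover have "z \<in> level_set u \<beta>" if y: "y \<in> level_set u l" and z: "z \<in> closed_segment x y" for y z
  proof -
    obtain h where h: "0 \<le> h" "h \<le> 1" "z = (1 - h) *\<^sub>R x + h *\<^sub>R y"
      using z unfolding closed_segment_def by blast
    have "0 \<le> l" "l \<le> u y" using assms y by (auto simp: level_set_def)
    then obtain b s where b: "b \<longlonglongrightarrow> y" "s \<longlonglongrightarrow> l" "\<And>n. s n \<le> v n (b n)"
      using lowerE by metis
    have br: "(\<lambda>n. b (r n)) \<longlonglongrightarrow> y" "(\<lambda>n. s (r n)) \<longlonglongrightarrow> l"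
      using LIMSEQ_subseq_LIMSEQ[OF _ r(1)] b(1,2) by (auto simp: o_def)
    have "\<forall>\<^sub>F n in sequentially. \<beta> < s (r n)" using br(2) assms(3) by (rule order_tendstoD)
    then have "\<forall>\<^sub>F n in sequentially. 0 \<le> \<beta> \<and> \<beta> \<le> v (r n) ((1 - h) *\<^sub>R c (r n) + h *\<^sub>R b (r n))"
    proof eventually_elim
      case (elim n)
      then have "b (r n) \<in> level_set (v (r n)) \<beta>"
        using b(3)[of "r n"] by (simp add: level_set_def)
      then have "closed_segment (c (r n)) (b (r n)) \<subseteq> level_set (v (r n)) \<beta>" by (rule c(2))
      moreover have "(1 - h) *\<^sub>R c (r n) + h *\<^sub>R b (r n) \<in> closed_segment (c (r n)) (b (r n))"
        using h unfolding closed_segment_def by blast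
      ultimately show ?case using assms(2) by (auto simp: level_set_def)
    qed
    moreover have "(\<lambda>n. (1 - h) *\<^sub>R c (r n) + h *\<^sub>R b (r n)) \<longlonglongrightarrow> z"
      unfolding h(3) by (intro tendsto_intros r br)
    ultimately have "\<beta> \<le> u z" using upper[OF r(1) _ tendsto_const] by blast
    then show ?thesis by (simp add: level_set_def)
  qed
  ultimately show ?thesis by (auto simp: level_set_def)
qed

text \<open>As \<open>\<beta>\<close> increases to \<open>l\<close>, the centres found at the levels \<open>\<beta>\<close> accumulate, and upper semicontinuity
  moves the limits of the segments into \<open>[u]\<^sub>l\<close>.\<close>

lemma limit_in_S_tilde_nc:
  assumes "\<And>n. v n \<in> S_tilde_nc"
  shows "u \<in> S_tilde_nc"
proof -
  have "\<exists>x\<in>level_set u l. \<forall>y\<in>level_set u l. closed_segment x y \<subseteq> level_set u l"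
    if l: "0 < l" "l \<le> 1" for l
  proof -
    \<comment> \<open>Levels that increase to \<open>l\<close> and stay above \<open>l / 2\<close>, so that all centres lie in one bounded set.\<close>
    define \<beta> where "\<beta> k = l - (l / 2) / real (Suc k)" for k
    have \<beta>: "l / 2 \<le> \<beta> k" "\<beta> k < l" for k
    proof -
      have "(l / 2) / real (Suc k) \<le> (l / 2) / 1" using l by (intro divide_left_mono) auto
      then show "l / 2 \<le> \<beta> k" unfolding \<beta>_def by linarith
      show "\<beta> k < l" using l by (simp add: \<beta>_def)
    qed
    have \<beta>_lim: "\<beta> \<longlonglongrightarrow> l"
    proof -
      have "(\<lambda>k. l - (l / 2) * (1 / real (Suc k))) \<longlonglongrightarrow> l - (l / 2) * 0"
        by (intro tendsto_intros LIMSEQ_Suc[OF lim_1_over_n])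
      then show ?thesis by (simp add: \<beta>_def[abs_def])
    qed
    have "\<exists>x\<in>level_set u (\<beta> k). \<forall>y\<in>level_set u l. closed_segment x y \<subseteq> level_set u (\<beta> k)" for k
      using \<beta>[of k] l by (intro limit_level_set_star_below assms) linarith+
    then obtain c where c: "\<And>k. c k \<in> level_set u (\<beta> k)"
      "\<And>k y. y \<in> level_set u l \<Longrightarrow> closed_segment (c k) y \<subseteq> level_set u (\<beta> k)"
      by metis
    have "range c \<subseteq> level_set u (l / 2)"
      using c(1) order_trans[OF \<beta>(1)] by (auto simp: level_set_def)
    moreover have "bounded (level_set u (l / 2))" using u l by (auto simp: fuzzy_base_def)
    ultimately have "bounded (range c)" using bounded_subset by blast
    then obtain x r where r: "strict_mono (r :: nat \<Rightarrow> nat)" "(\<lambda>n. c (r n)) \<longlonglongrightarrow> x"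
      using bounded_imp_convergent_subsequence unfolding o_def by blast
    have \<beta>r: "(\<lambda>n. \<beta> (r n)) \<longlonglongrightarrow> l" using LIMSEQ_subseq_LIMSEQ[OF \<beta>_lim r(1)] by (simp add: o_def)
    have usc: "z \<in> level_set u l" if "w \<longlonglongrightarrow> z" "\<And>n. w n \<in> level_set u (\<beta> (r n))" for w z
    proof -
      have "(w n, \<beta> (r n)) \<in> endograph u" for n
        using that(2)[of n] \<beta>[of "r n"] l by (simp add: mem_endograph_iff level_set_def)
      moreover have "closed (endograph u)" using u closed_endograph by (auto simp: fuzzy_base_def)
      ultimately have "(z, l) \<in> endograph u"
        by (intro closed_sequentially[OF _ _ tendsto_Pair[OF that(1) \<beta>r]])
      then show ?thesis by (simp add: mem_endograph_iff level_set_def)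
    qed
    have "closed_segment x y \<subseteq> level_set u l" if y: "y \<in> level_set u l" for y
    proof
      fix z assume "z \<in> closed_segment x y"
      then obtain h where h: "0 \<le> h" "h \<le> 1" "z = (1 - h) *\<^sub>R x + h *\<^sub>R y"
        unfolding closed_segment_def by blast
      show "z \<in> level_set u l"
      proof (rule usc)
        show "(\<lambda>n. (1 - h) *\<^sub>R c (r n) + h *\<^sub>R y) \<longlonglongrightarrow> z"
          unfolding h(3) by (intro tendsto_intros r)
        show "(1 - h) *\<^sub>R c (r n) + h *\<^sub>R y \<in> level_set u (\<beta> (r n))" for n
          using c(2)[OF y, of "r n"] h unfolding closed_segment_def by blast
      qed
    qed
    moreover have "x \<in> level_set u l" by (rule usc[OF r(2)]) (rule c(1))
    ultimately show ?thesis by blast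
  qed
  then show ?thesis using u by (simp add: S_tilde_nc_def)
qed

end

section \<open>Compactness and boundedness in the endograph metric\<close>

lemma H_end_lessD:
  fixes u v :: "real ^ 'm::finite \<Rightarrow> real"
  assumes "u \<in> fuzzy_base" "v \<in> fuzzy_base" "H_end u v < e" "p \<in> endograph u"
  shows "\<exists>q\<in>endograph v. dist p q < e"
proof -
  \<comment> \<open>The real-valued distance carries information only if the extended one is finite. It is at
    most \<open>1\<close>, since every point can be dropped to height \<open>0\<close>.\<close>
  have near: "\<exists>q\<in>endograph w'. dist p q \<le> 1"
    if "p \<in> endograph w" "w' \<in> fuzzy_base" for p and w w' :: "real ^ 'm \<Rightarrow> real"
  proof (rule bexI[of _ "(fst p, 0)"])
    show "dist p (fst p, 0) \<le> 1" using that by (auto simp: endograph_def dist_prod_def)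
    show "(fst p, 0) \<in> endograph w'" using fuzzy_base_range[OF that(2)] by (simp add: mem_endograph_iff)
  qed
  have "hausdorff_edist (endograph u) (endograph v) \<le> ennreal 1"
    by (rule hausdorff_edist_le) (metis near assms(1,2) dist_commute)+
  then have "hausdorff_edist (endograph u) (endograph v) < top"
    by (rule le_less_trans) simp
  then show ?thesis using assms(3,4) hausdorff_dist_lessD unfolding H_end_def by blast
qed

text \<open>Being closer than \<open>\<alpha> / 2\<close> can lower the height \<open>\<alpha>\<close> of a point at most to \<open>\<alpha> / 2\<close>.\<close>

lemma level_set_near:
  fixes u v :: "real ^ 'm::finite \<Rightarrow> real"
  assumes "u \<in> fuzzy_base" "v \<in> fuzzy_base" "\<alpha> \<in> {0<..1}" "H_end u v < \<alpha> / 2"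
  shows "level_set u \<alpha> \<subseteq> {x. \<exists>y\<in>level_set v (\<alpha> / 2). dist x y < \<alpha> / 2}"
proof
  fix x assume "x \<in> level_set u \<alpha>"
  then have "(x, \<alpha>) \<in> endograph u" using assms(3) by (simp add: level_set_def mem_endograph_iff)
  then obtain y t where q: "(y, t) \<in> endograph v" "dist (x, \<alpha>) (y, t) < \<alpha> / 2"
    using H_end_lessD[OF assms(1,2,4)] by (metis prod.collapse)
  have "dist x y < \<alpha> / 2" "dist \<alpha> t < \<alpha> / 2"
    using q(2) dist_fst_le[of "(x, \<alpha>)" "(y, t)"] dist_snd_le[of "(x, \<alpha>)" "(y, t)"] by auto
  moreover from this(2) have "\<alpha> / 2 \<le> t" by (simp add: dist_real_def abs_if split: if_splits)
  ultimately show "x \<in> {x. \<exists>y\<in>level_set v (\<alpha> / 2). dist x y < \<alpha> / 2}"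
    using q(1) by (auto simp: level_set_def mem_endograph_iff intro!: exI[of _ y])
qed

text \<open>This covers both total boundedness, where the approximating family \<open>V\<close> is finite and depends on the error,
  and closures, where \<open>V\<close> is the original family for every error.\<close>

lemma levelwise_bounded_by_approximation:
  fixes U :: "(real ^ 'm::finite \<Rightarrow> real) set"
  assumes "U \<subseteq> fuzzy_base"
    and "\<And>e. 0 < e \<Longrightarrow> \<exists>V. V \<subseteq> fuzzy_base \<and> levelwise_bounded V \<and> (\<forall>u\<in>U. \<exists>v\<in>V. H_end u v < e)"
  shows "levelwise_bounded U"
  unfolding levelwise_bounded_def
proof
  fix \<alpha> :: real assume \<alpha>: "\<alpha> \<in> {0<..1}"
  then obtain V where V: "V \<subseteq> fuzzy_base" "levelwise_bounded V" "\<And>u. u \<in> U \<Longrightarrow> \<exists>v\<in>V. H_end u v < \<alpha> / 2"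
    using assms(2)[of "\<alpha> / 2"] by auto
  have "(\<Union>u\<in>U. level_set u \<alpha>) \<subseteq> {x. \<exists>y\<in>(\<Union>v\<in>V. level_set v (\<alpha> / 2)). dist x y < \<alpha> / 2}"
    using V(1,3) assms(1) level_set_near[OF _ _ \<alpha>] by fastforce
  moreover have "bounded (\<Union>v\<in>V. level_set v (\<alpha> / 2))"
    using V(2) \<alpha> by (simp add: levelwise_bounded_def)
  ultimately show "bounded (\<Union>u\<in>U. level_set u \<alpha>)"
    using bounded_metric_neighbourhood bounded_subset by blast
qed

lemma levelwise_bounded_finite:
  "finite V \<Longrightarrow> V \<subseteq> fuzzy_base \<Longrightarrow> levelwise_bounded V"
  by (auto simp: levelwise_bounded_def fuzzy_base_def)

text \<open>What distinguishes a suitable class of fuzzy sets is closedness under limits of endographs.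
  The closure of a levelwise bounded family is again levelwise bounded, so the extraction of
  convergent subsequences applies to sequences in the closure itself.\<close>

lemma relatively_compact_iff_levelwise_bounded:
  fixes X U :: "(real ^ 'm::finite \<Rightarrow> real) set"
  assumes X: "X \<subseteq> fuzzy_base" and U: "U \<subseteq> X"
    and limits: "\<And>v u. endograph_limit v u \<Longrightarrow> (\<And>n. v n \<in> X) \<Longrightarrow> u \<in> X"
  shows "relatively_compact_in X H_end U \<longleftrightarrow> levelwise_bounded U"
    and "Metric_space.mtotally_bounded X H_end U \<longleftrightarrow> levelwise_bounded U"
proof -
  interpret Metric_space X H_end by (rule Metric_space.subspace[OF Metric_space_H_end X])
  have compact_imp: "mtotally_bounded U" if "relatively_compact_in X H_end U"
  proof -
    have "mtotally_bounded (mtopology closure_of U)"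
      using that compactin_imp_mtotally_bounded unfolding relatively_compact_in_def by blast
    then show ?thesis
      using mtotally_bounded_subset closure_of_subset[of U mtopology] U by simp
  qed
  have tb_imp: "levelwise_bounded U" if tb: "mtotally_bounded U"
  proof (rule levelwise_bounded_by_approximation)
    fix e :: real assume "0 < e"
    with tb have "\<exists>V. finite V \<and> V \<subseteq> U \<and> U \<subseteq> (\<Union>v\<in>V. mball v e)"
      unfolding mtotally_bounded_def by simp
    then obtain V where V: "finite V" "V \<subseteq> U" "U \<subseteq> (\<Union>v\<in>V. mball v e)"
      by (elim exE conjE)
    have "V \<subseteq> fuzzy_base" using V(2) U X by blast
    moreover have "\<exists>v\<in>V. H_end u v < e" if "u \<in> U" for u
    proof -
      obtain v where "v \<in> V" "u \<in> mball v e" using subsetD[OF V(3) \<open>u \<in> U\<close>] by (elim UN_E)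
      then show ?thesis using commute[of u v] by (intro bexI[of _ v]) auto
    qed
    ultimately show "\<exists>V. V \<subseteq> fuzzy_base \<and> levelwise_bounded V \<and> (\<forall>u\<in>U. \<exists>v\<in>V. H_end u v < e)"
        using levelwise_bounded_finite[OF V(1)] by (intro exI[of _ V]) simp
  qed (use U X in blast)
  have bdd_imp: "relatively_compact_in X H_end U" if bdd: "levelwise_bounded U"
  proof -
    define W where "W = mtopology closure_of U"
    have WX: "W \<subseteq> X" unfolding W_def metric_closure_of by blast
    have W: "levelwise_bounded W"
    proof (rule levelwise_bounded_by_approximation)
      fix e :: real assume "0 < e"
      then have "\<forall>w\<in>W. \<exists>v\<in>U. H_end w v < e" by (auto simp: W_def metric_closure_of)
      then show "\<exists>V. V \<subseteq> fuzzy_base \<and> levelwise_bounded V \<and> (\<forall>u\<in>W. \<exists>v\<in>V. H_end u v < e)"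
        using bdd U X by (intro exI[of _ U]) simp
    qed (use WX X in blast)
    have "compactin mtopology W"
      unfolding compactin_sequentially
    proof (intro conjI allI impI)
      fix w :: "nat \<Rightarrow> real ^ 'm \<Rightarrow> real" assume w: "range w \<subseteq> W"
      have wn: "w n \<in> W" "w n \<in> X" "w n \<in> fuzzy_base" for n using w WX X by auto
      obtain r C where r: "strict_mono r" "kuratowski_limit (\<lambda>n. endograph (w (r n))) C"
        using kuratowski_compactness[of "\<lambda>n. endograph (w n)"] endograph_nonempty wn(3) by blast
      have bdd': "levelwise_bounded (range (\<lambda>n. w (r n)))"
        by (rule levelwise_bounded_subset[OF W]) (use wn(1) in auto)
      obtain u where u: "u \<in> fuzzy_base" "C = endograph u"
        using wn(3) bdd' r(2) by (rule kuratowski_limit_of_endographs)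
      interpret L: endograph_limit "\<lambda>n. w (r n)" u
        using wn(3) u bdd' r(2) by unfold_locales auto
      have "u \<in> X" using limits[OF L.endograph_limit_axioms] wn(2) by simp
      then have lim: "limitin mtopology (w \<circ> r) u sequentially"
        using L.H_end_tendsto_zero wn(2) by (simp add: limitin_metric_dist_null)
      have "u \<in> W"
        by (rule limitin_closedin[OF lim, of W])
          (use wn(1) in \<open>auto simp: W_def closedin_closure_of\<close>)
      with r(1) lim show "\<exists>l r. l \<in> W \<and> strict_mono r \<and> limitin mtopology (w \<circ> r) l sequentially"
        by blast
    qed (rule WX)
    then show ?thesis by (simp add: relatively_compact_in_def W_def)
  qed
  show "relatively_compact_in X H_end U \<longleftrightarrow> levelwise_bounded U"
    and "mtotally_bounded U \<longleftrightarrow> levelwise_bounded U"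
    using compact_imp tb_imp bdd_imp by blast+
qed

section \<open>Level sets of the three classes\<close>

lemma level_set_compact:
  assumes "u \<in> fuzzy_base" "\<alpha> \<in> {0<..1}"
  shows "level_set u \<alpha> \<noteq> {}" "compact (level_set u \<alpha>)"
proof -
  obtain x where "u x = 1" using assms(1) unfolding fuzzy_base_def by blast
  then have "x \<in> level_set u \<alpha>" using assms(2) by (simp add: level_set_def)
  then show "level_set u \<alpha> \<noteq> {}" by blast
  show "compact (level_set u \<alpha>)"
    using assms upper_semicontinuous_iff_closed_level_sets[of u]
    by (simp add: fuzzy_base_def compact_eq_bounded_closed)
qed

lemma level_set_convex:
  assumes "u \<in> E_nc"
  shows "convex (level_set u \<alpha>)"
proof (rule convexI)
  fix x y :: "real ^ 'a" and a b :: real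
  assume xy: "x \<in> level_set u \<alpha>" "y \<in> level_set u \<alpha>" and ab: "0 \<le> a" "0 \<le> b" "a + b = 1"
  have b: "b = 1 - a" and "a \<in> {0..1}" using ab by auto
  then have "min (u x) (u y) \<le> u (a *\<^sub>R x + b *\<^sub>R y)" using assms unfolding E_nc_def by blast
  then show "a *\<^sub>R x + b *\<^sub>R y \<in> level_set u \<alpha>" using xy by (simp add: level_set_def)
qed

text \<open>A common star centre has height \<open>1\<close> and therefore belongs to every level set.\<close>

lemma S_nc_subset_S_tilde_nc: "S_nc \<subseteq> S_tilde_nc"
proof
  fix u :: "real ^ 'm \<Rightarrow> real" assume u: "u \<in> S_nc"
  then obtain c x0 where c: "\<And>y l. l \<in> {0..1} \<Longrightarrow> u y \<le> u (l *\<^sub>R y + (1 - l) *\<^sub>R c)" and x0: "u x0 = 1"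
    unfolding S_nc_def fuzzy_base_def by blast
  have "1 \<le> u c" using c[of 0 x0] x0 by simp
  moreover have "closed_segment c y \<subseteq> level_set u \<alpha>" if "y \<in> level_set u \<alpha>" for y \<alpha>
  proof
    fix z assume "z \<in> closed_segment c y"
    then obtain l where "0 \<le> l" "l \<le> 1" "z = l *\<^sub>R y + (1 - l) *\<^sub>R c"
      unfolding closed_segment_def by (auto simp: add.commute)
    then have "u y \<le> u z" using c by simp
    then show "z \<in> level_set u \<alpha>" using that by (simp add: level_set_def)
  qed
  ultimately have "\<forall>\<alpha>\<in>{0<..1}. \<exists>x\<in>level_set u \<alpha>. \<forall>y\<in>level_set u \<alpha>. closed_segment x y \<subseteq> level_set u \<alpha>"
    by (intro ballI bexI[of _ c]) (auto simp: level_set_def)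
  then show "u \<in> S_tilde_nc" using u by (simp add: S_tilde_nc_def S_nc_def)
qed

lemma level_set_starlike:
  assumes "u \<in> S_tilde_nc" "\<alpha> \<in> {0<..1}"
  shows "starlike (level_set u \<alpha>)"
  using assms unfolding S_tilde_nc_def starlike_def by blast

theorem theorem9p16:
  fixes X U :: "(real ^ 'm::finite \<Rightarrow> real) set"
    and \<K> :: "(real ^ 'm) set set"
  assumes "(X, \<K>) = (S_tilde_nc, compact_star_sets) \<or>
           (X, \<K>) = (S_nc, compact_star_sets) \<or>
           (X, \<K>) = (E_nc, compact_convex_sets)"
    and "U \<subseteq> X"
  shows "(relatively_compact_in X H_end U \<longleftrightarrow> Metric_space.mtotally_bounded X H_end U) \<and>
         (Metric_space.mtotally_bounded X H_end U \<longleftrightarrow>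
           (\<forall>\<alpha>\<in>{0<..1}. Metric_space.mbounded compact_sets hausdorff_dist
             ((\<lambda>u. level_set u \<alpha>) ` U))) \<and>
         ((\<forall>\<alpha>\<in>{0<..1}. Metric_space.mbounded compact_sets hausdorff_dist
             ((\<lambda>u. level_set u \<alpha>) ` U)) \<longleftrightarrow>
           (\<forall>\<alpha>\<in>{0<..1}. Metric_space.mbounded \<K> hausdorff_dist
             ((\<lambda>u. level_set u \<alpha>) ` U))) \<and>
         ((\<forall>\<alpha>\<in>{0<..1}. Metric_space.mbounded \<K> hausdorff_dist
             ((\<lambda>u. level_set u \<alpha>) ` U)) \<longleftrightarrow>
           (\<forall>\<alpha>\<in>{0<..1}. bounded (\<Union>u\<in>U. level_set u \<alpha>)))"
proof -
  have X: "X \<subseteq> fuzzy_base"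
    using assms(1) by (auto simp: E_nc_def S_nc_def S_tilde_nc_def)
  have limits: "u \<in> X" if "endograph_limit v u" "\<And>n. v n \<in> X" for v u
    using assms(1) that endograph_limit.limit_in_E_nc endograph_limit.limit_in_S_nc
      endograph_limit.limit_in_S_tilde_nc by blast
  have \<K>: "Metric_space \<K> hausdorff_dist" "\<K> \<subseteq> compact_sets"
    using assms(1) Metric_space_compact_star_sets Metric_space_compact_convex_sets
    by (auto simp: compact_star_sets_def compact_convex_sets_def compact_sets_def)
  have level: "level_set u \<alpha> \<in> \<K>" if "u \<in> X" "\<alpha> \<in> {0<..1}" for u \<alpha>
  proof -
    have "level_set u \<alpha> \<noteq> {}" "compact (level_set u \<alpha>)" using level_set_compact X that by blast+
    then show ?thesis
      using assms(1) that level_set_convex level_set_starlike S_nc_subset_S_tilde_nc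
      by (auto simp: compact_star_sets_def compact_convex_sets_def)
  qed
  have mbdd: "Metric_space.mbounded M hausdorff_dist ((\<lambda>u. level_set u \<alpha>) ` U) \<longleftrightarrow>
      bounded (\<Union>u\<in>U. level_set u \<alpha>)"
    if "Metric_space M hausdorff_dist" "\<K> \<subseteq> M" "M \<subseteq> compact_sets" "\<alpha> \<in> {0<..1}" for M \<alpha>
  proof (rule mbounded_hausdorff_iff[OF that(1,3)])
    show "(\<lambda>u. level_set u \<alpha>) ` U \<subseteq> M"
      using level[OF subsetD[OF assms(2)] that(4)] that(2) by (auto intro: subsetD)
  qed
  have "relatively_compact_in X H_end U \<longleftrightarrow> levelwise_bounded U"
    and "Metric_space.mtotally_bounded X H_end U \<longleftrightarrow> levelwise_bounded U"
    using relatively_compact_iff_levelwise_bounded[OF X assms(2)] limits by simp_all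
  then show ?thesis
    using mbdd[OF Metric_space_compact_sets \<K>(2) order_refl] mbdd[OF \<K>(1) order_refl \<K>(2)]
    unfolding levelwise_bounded_def by simp
qed

end
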